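(* For every $a\in\{1,\dots,D\}$, in terms of last quasi-determinants of truncated Jacobi matrices, $$\rho_{a,[k]}=(n_a\cdot J)_{[k],[k-1]}\Big(\Theta_*\big((n_a\cdot J)^{[k]}-q_a\mathbb I^{[k]}\big)\Big)^{-1}\quad(k\ge1),\qquad \alpha_{a,[k]}=\Theta_*\big((n_a\cdot J)^{[k+1]}-q_a\mathbb I^{[k+1]}\big)\quad(k\ge0).$$
   Context: Let $D\ge 1$. For $k\in\mathbb Z_+$ let $[k]=\{\alpha\in\mathbb Z_+^D:|\alpha|=k\}$, ordered so that $\alpha>\alpha'$ iff at the first coordinate where they differ the entry of $\alpha$ is smaller. $\chi_{[k]}(x)$ is the column vector of monomials $x^\alpha$, $\alpha\in[k]$, and $\chi$ stacks $\chi_{[0]},\chi_{[1]},\dots$. Semi-infinite matrices are partitioned in blocks $A_{[k],[\ell]}\in\mathbb R^{|[k]|\times|[\ell]|}$; $A^{[\ell]}$ is the truncation to block indices $0,\dots,\ell-1$. Shift matrices: $\Lambda_b$ has as only nonzero blocks $(\Lambda_b)_{[k],[k+1]}$, with entries $\delta_{\alpha+e_b,\alpha'}$, $\alpha\in[k]$, $\alpha'\in[k+1]$; $n\cdot\Lambda=\sum_bn_b\Lambda_b$. Discrete flows: fix an invertible $N=(n_{a,b})\in GL(\mathbb R^D)$, $n_a=(n_{a,1},\dots,n_{a,D})^\top$, and $q\in\mathbb R^D$ with all $q_a\ne0$. Let $\mu$ be a Borel measure with finite moments and support in $\{x:|n_a\cdot x|<|q_a|,\ a=1,\dots,D\}$.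 For $m\in\mathbb Z^D$, $d\mu_m(x)=\big[\prod_a(n_a\cdot x-q_a)^{m_a}\big]d\mu(x)$ has moment matrix $G(m)=\int\chi\,d\mu_m\,\chi^\top$, and it is assumed that for each $m$, $G(m)=S(m)^{-1}H(m)(S(m)^{-1})^\top$ with $S(m)$ block lower triangular with identity diagonal blocks and $H(m)=\operatorname{diag}(H_{[0]}(m),H_{[1]}(m),\dots)$ with invertible blocks. $(T_af)(m)=f(m+e_a)$; the dependence on $m$ is omitted. Jacobi type matrices: $J_b=S\Lambda_bS^{-1}$, $n\cdot J=\sum_bn_bJ_b$. Further, $\rho_{a,[k]}$ are the blocks in position $([k],[k-1])$ of $M_a=S(T_aS)^{-1}$, that is $\rho_{a,[k]}=H_{[k]}\big[(n_a\cdot\Lambda)_{[k-1],[k]}\big]^\top(T_aH_{[k-1]})^{-1}$, and $\alpha_{a,[k]}=(T_aH_{[k]})H_{[k]}^{-1}$. The last quasi-determinant of a block matrix is the Schur complement $\Theta_*\begin{pmatrix}A&B\\C&E\end{pmatrix}=E-CA^{-1}B$, where $E$ is the lower right diagonal block and $A$ (assumed invertible) consists of all other block rows and columns; for a single block it is the block itself. *)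

theory Defs
  imports
    "HOL-Analysis.Analysis"
    "HOL-Library.Fun_Lexorder"
    "Jordan_Normal_Form.Gauss_Jordan_Elimination"
begin

no_notation Matrix.vec_index (infixl "$" 100)

text \<open>
  The coordinates are indexed by a finite linearly ordered type \<open>'d\<close>, which stands for
  \<open>{1,...,D}\<close>; \<open>D \<ge> 1\<close> holds because types are nonempty.
\<close>

type_synonym 'd mindex = "'d \<Rightarrow> nat"

definition mdeg :: "'d::finite mindex \<Rightarrow> nat" where
  "mdeg \<alpha> = (\<Sum>i\<in>UNIV. \<alpha> i)"

definition mindices :: "nat \<Rightarrow> 'd::finite mindex set" where
  "mindices k = {\<alpha>. mdeg \<alpha> = k}"

definition monomial :: "'d::finite mindex \<Rightarrow> real ^ 'd \<Rightarrow> real" where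
  "monomial \<alpha> x = (\<Prod>i\<in>UNIV. (x $ i) ^ \<alpha> i)"

text \<open>
  In increasing order, \<open>\<alpha>\<close> precedes \<open>\<beta>\<close> iff at the first coordinate where they differ the
  entry of \<open>\<beta>\<close> is the smaller one.
\<close>

definition mlist :: "nat \<Rightarrow> 'd::{finite,linorder} mindex list" where
  "mlist k = (THE xs. sorted_wrt (\<lambda>\<alpha> \<beta>. less_fun \<beta> \<alpha>) xs \<and> set xs = mindices k)"

definition mlist_upto :: "nat \<Rightarrow> 'd::{finite,linorder} mindex list" where
  "mlist_upto l = concat (map mlist [0..<l])"

text \<open>
  Semi-infinite matrices carry multi-indices as row and column labels.  The blocks and
  truncations are ordinary matrices, laid out in the order of the multi-indices.
\<close>

type_synonym 'd smat = "'d mindex \<Rightarrow> 'd mindex \<Rightarrow> real"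

definition submat :: "'d smat \<Rightarrow> 'd mindex list \<Rightarrow> 'd mindex list \<Rightarrow> real Matrix.mat" where
  "submat A xs ys = Matrix.mat (length xs) (length ys) (\<lambda>(i, j). A (xs ! i) (ys ! j))"

definition block :: "'d::{finite,linorder} smat \<Rightarrow> nat \<Rightarrow> nat \<Rightarrow> real Matrix.mat" where
  "block A k l = submat A (mlist k) (mlist l)"

definition trunc :: "'d::{finite,linorder} smat \<Rightarrow> nat \<Rightarrow> real Matrix.mat" where
  "trunc A l = submat A (mlist_upto l) (mlist_upto l)"

text \<open>
  The product is meant for a left factor with finitely many nonzero entries in each row.
  All products below are of this kind, as block lower triangular matrices, block diagonal
  matrices and shift matrices are row-finite.
\<close>

definition smult :: "'d smat \<Rightarrow> 'd smat \<Rightarrow> 'd smat" (infixl "\<star>" 70) where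
  "A \<star> B = (\<lambda>\<alpha> \<beta>. \<Sum>\<gamma> | A \<alpha> \<gamma> \<noteq> 0. A \<alpha> \<gamma> * B \<gamma> \<beta>)"

definition sone :: "'d smat" where
  "sone = (\<lambda>\<alpha> \<beta>. if \<alpha> = \<beta> then 1 else 0)"

definition stransp :: "'d smat \<Rightarrow> 'd smat" where
  "stransp A = (\<lambda>\<alpha> \<beta>. A \<beta> \<alpha>)"

text \<open>
  For a block lower triangular matrix with identity diagonal blocks, forward substitution
  shows that \<open>A \<star> B = sone\<close> already determines \<open>B\<close>, so the description is proper.
\<close>

definition sinv :: "'d smat \<Rightarrow> 'd smat" where
  "sinv A = (THE B. A \<star> B = sone \<and> B \<star> A = sone)"

definition block_lower_unitriangular :: "'d::finite smat \<Rightarrow> bool" where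
  "block_lower_unitriangular A \<longleftrightarrow>
     (\<forall>\<alpha> \<beta>. mdeg \<alpha> < mdeg \<beta> \<longrightarrow> A \<alpha> \<beta> = 0) \<and>
     (\<forall>\<alpha> \<beta>. mdeg \<alpha> = mdeg \<beta> \<longrightarrow> A \<alpha> \<beta> = sone \<alpha> \<beta>)"

definition block_diagonal :: "'d::finite smat \<Rightarrow> bool" where
  "block_diagonal A \<longleftrightarrow> (\<forall>\<alpha> \<beta>. mdeg \<alpha> \<noteq> mdeg \<beta> \<longrightarrow> A \<alpha> \<beta> = 0)"

definition shift_mat :: "'d \<Rightarrow> 'd smat" where
  "shift_mat b = (\<lambda>\<alpha> \<beta>. if \<beta> = \<alpha>(b := \<alpha> b + 1) then 1 else 0)"

definition measure_support :: "'a::topological_space measure \<Rightarrow> 'a set" where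
  "measure_support M = {x. \<forall>U. open U \<and> x \<in> U \<longrightarrow> emeasure M U > 0}"

text \<open>The density of the deformed (in general signed) measure with respect to the original one.\<close>

definition flow_weight :: "real ^ 'd ^ 'd \<Rightarrow> real ^ 'd \<Rightarrow> int ^ 'd \<Rightarrow> real ^ 'd \<Rightarrow> real" where
  "flow_weight N q m x = (\<Prod>a\<in>UNIV. (inner (N $ a) x - q $ a) powi (m $ a))"

definition moment_matrix ::
  "(real ^ 'd) measure \<Rightarrow> real ^ 'd ^ 'd \<Rightarrow> real ^ 'd \<Rightarrow> int ^ 'd \<Rightarrow> 'd::finite smat" where
  "moment_matrix \<mu> N q m = (\<lambda>\<alpha> \<beta>. \<integral>x. monomial \<alpha> x * monomial \<beta> x * flow_weight N q m x \<partial>\<mu>)"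

definition latshift :: "'d \<Rightarrow> (int ^ 'd \<Rightarrow> 'b) \<Rightarrow> int ^ 'd \<Rightarrow> 'b" where
  "latshift a f = (\<lambda>m. f (m + axis a 1))"

definition jacobi :: "'d smat \<Rightarrow> 'd \<Rightarrow> 'd smat" where
  "jacobi S b = S \<star> shift_mat b \<star> sinv S"

definition dir_jacobi :: "real ^ 'd \<Rightarrow> 'd::finite smat \<Rightarrow> 'd smat" where
  "dir_jacobi n S = (\<lambda>\<alpha> \<beta>. \<Sum>b\<in>UNIV. n $ b * jacobi S b \<alpha> \<beta>)"

text \<open>The library inverse is partial; \<open>minv A\<close> is only meaningful for invertible \<open>A\<close>.\<close>

definition minv :: "real Matrix.mat \<Rightarrow> real Matrix.mat" where
  "minv A = the (mat_inverse A)"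

definition rho_block ::
  "(int ^ 'd::{finite,linorder} \<Rightarrow> 'd smat) \<Rightarrow> 'd \<Rightarrow> nat \<Rightarrow> int ^ 'd::{finite,linorder} \<Rightarrow> real Matrix.mat" where
  "rho_block S a k m = block (S m \<star> sinv (latshift a S m)) k (k - 1)"

definition alpha_block ::
  "(int ^ 'd::{finite,linorder} \<Rightarrow> 'd smat) \<Rightarrow> 'd \<Rightarrow> nat \<Rightarrow> int ^ 'd::{finite,linorder} \<Rightarrow> real Matrix.mat" where
  "alpha_block H a k m = block (latshift a H m) k k * minv (block (H m) k k)"

text \<open>
  The last quasi-determinant of a square block matrix depends on the block partition only
  through the size \<open>s\<close> of the last diagonal block.
\<close>

definition last_quasidet :: "nat \<Rightarrow> real Matrix.mat \<Rightarrow> real Matrix.mat" where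
  "last_quasidet s X =
     (if dim_row X = s then X
      else case split_block X (dim_row X - s) (dim_col X - s) of
        (A, B, C, E) \<Rightarrow> E - C * minv A * B)"

definition last_quasidet_exists :: "nat \<Rightarrow> real Matrix.mat \<Rightarrow> bool" where
  "last_quasidet_exists s X \<longleftrightarrow>
     dim_row X = s \<or> invertible_mat (fst (split_block X (dim_row X - s) (dim_col X - s)))"

definition shifted_jacobi_trunc ::
  "real ^ 'd::{finite,linorder} \<Rightarrow> real \<Rightarrow> 'd smat \<Rightarrow> nat \<Rightarrow> real Matrix.mat" where
  "shifted_jacobi_trunc n c S l =
     trunc (dir_jacobi n S) l - c \<cdot>\<^sub>m 1\<^sub>m (length (mlist_upto l :: 'd mindex list))"

end

theory Submission
  imports Defs "Jordan_Normal_Form.Determinant"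
begin

text \<open>
  Fix \<open>a\<close> and write \<open>S', H'\<close> for the factors at \<open>m + e\<^sub>a\<close> and \<open>L = n\<^sub>a \<sqdot> \<Lambda> - q\<^sub>a\<close>.  Multiplying the
  measure by \<open>n\<^sub>a \<sqdot> x - q\<^sub>a\<close> multiplies the moment matrix by \<open>L\<close> from the left.  Inserting both
  factorizations, the upper factor \<open>U = S' L S\<^sup>-\<^sup>1\<close> and the lower unitriangular factor
  \<open>M = S S'\<^sup>-\<^sup>1\<close> satisfy \<open>U H = H' M\<^sup>T\<close>, while \<open>n\<^sub>a \<sqdot> J - q\<^sub>a = S L S\<^sup>-\<^sup>1 = M U\<close>.  This is a block LU
  factorization, whose last quasi-determinants are the diagonal blocks of \<open>U\<close>, that is
  \<open>H'\<^bsub>[k]\<^esub> H\<^bsub>[k]\<^esub>\<^sup>-\<^sup>1\<close>.  Since \<open>U\<close> has only one block diagonal above the main one, \<open>U H = H' M\<^sup>T\<close> makes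
  \<open>M\<close> block bidiagonal, and the subdiagonal blocks of \<open>M U\<close> give \<open>\<rho>\<close>.
\<close>

no_notation Matrix.vec_index (infixl "$" 100)

section \<open>Row-finite semi-infinite matrices\<close>

lemma finite_mdeg_le: "finite {\<alpha> :: 'd::finite mindex. mdeg \<alpha> \<le> n}"
proof (rule finite_subset)
  show "finite (Pi\<^sub>E (UNIV :: 'd set) (\<lambda>_. {..n}))"
    by (intro finite_PiE) auto
  have "\<alpha> i \<le> mdeg \<alpha>" for \<alpha> :: "'d mindex" and i
    unfolding mdeg_def by (rule member_le_sum) auto
  then show "{\<alpha> :: 'd mindex. mdeg \<alpha> \<le> n} \<subseteq> Pi\<^sub>E UNIV (\<lambda>_. {..n})"
    using le_trans by (fastforce simp: PiE_def extensional_def)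
qed

lemma finite_mindices: "finite (mindices k :: 'd::finite mindex set)"
  by (rule finite_subset[OF _ finite_mdeg_le[of k]]) (auto simp: mindices_def)

text \<open>\<open>p\<close> bounds the number of block superdiagonals that may be nonzero, while
  nothing is asked below the diagonal. Finitely many multi-indices have bounded degree, so every row
  is finite and \<open>\<star>\<close> is an honest product. The value 0 covers block lower
  triangular and block diagonal matrices, the value 1 the shifts.\<close>

definition band :: "nat \<Rightarrow> 'd::finite smat \<Rightarrow> bool" where
  "band p A \<longleftrightarrow> (\<forall>\<alpha> \<beta>. mdeg \<alpha> + p < mdeg \<beta> \<longrightarrow> A \<alpha> \<beta> = 0)"

lemma bandD: "band p A \<Longrightarrow> mdeg \<alpha> + p < mdeg \<beta> \<Longrightarrow> A \<alpha> \<beta> = 0"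
  by (simp add: band_def)

lemma band_nonzero: "band p A \<Longrightarrow> A \<alpha> \<beta> \<noteq> 0 \<Longrightarrow> mdeg \<beta> \<le> mdeg \<alpha> + p"
  by (meson bandD not_le)

lemma band_row_finite: "band p A \<Longrightarrow> finite {\<gamma>. A \<alpha> \<gamma> \<noteq> 0}"
  by (rule finite_subset[OF _ finite_mdeg_le[of "mdeg \<alpha> + p"]]) (auto dest: band_nonzero)

text \<open>The sum defining \<open>\<star>\<close> runs over the support of one row. It and the sum
  over \<open>F\<close> both equal the sum over the union, so different products can be compared
  over one convenient index set.\<close>

lemma smult_eq_sum:
  assumes "band p A" "finite F" "\<And>\<gamma>. \<gamma> \<notin> F \<Longrightarrow> A \<alpha> \<gamma> * B \<gamma> \<beta> = 0"
  shows "(A \<star> B) \<alpha> \<beta> = (\<Sum>\<gamma>\<in>F. A \<alpha> \<gamma> * B \<gamma> \<beta>)"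
proof -
  have "(A \<star> B) \<alpha> \<beta> = (\<Sum>\<gamma>\<in>{\<gamma>. A \<alpha> \<gamma> \<noteq> 0} \<union> F. A \<alpha> \<gamma> * B \<gamma> \<beta>)"
    unfolding smult_def using band_row_finite[OF assms(1)] assms(2)
    by (intro sum.mono_neutral_left) auto
  also have "\<dots> = (\<Sum>\<gamma>\<in>F. A \<alpha> \<gamma> * B \<gamma> \<beta>)"
    using band_row_finite[OF assms(1)] assms(2,3)
    by (intro sum.mono_neutral_right) auto
  finally show ?thesis .
qed

lemma smult_eq_sum_le:
  assumes "band p A" "mdeg \<alpha> + p \<le> n"
  shows "(A \<star> B) \<alpha> \<beta> = (\<Sum>\<gamma> | mdeg \<gamma> \<le> n. A \<alpha> \<gamma> * B \<gamma> \<beta>)"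
  using assms by (intro smult_eq_sum[OF _ finite_mdeg_le]) (auto simp: bandD)

lemma smult_nonzeroE:
  assumes "(A \<star> B) \<alpha> \<beta> \<noteq> 0"
  obtains \<gamma> where "A \<alpha> \<gamma> \<noteq> 0" "B \<gamma> \<beta> \<noteq> 0"
  using assms unfolding smult_def by (metis (no_types, lifting) mult_not_zero sum.neutral)

lemma band_smult:
  assumes "band p A" "band r B"
  shows "band (p + r) (A \<star> B)"
  unfolding band_def
proof (intro allI impI)
  fix \<alpha> \<beta> :: "'a mindex" assume *: "mdeg \<alpha> + (p + r) < mdeg \<beta>"
  show "(A \<star> B) \<alpha> \<beta> = 0"
  proof (rule ccontr)
    assume "(A \<star> B) \<alpha> \<beta> \<noteq> 0"
    then obtain \<gamma> where "A \<alpha> \<gamma> \<noteq> 0" "B \<gamma> \<beta> \<noteq> 0" by (rule smult_nonzeroE)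
    with * band_nonzero[OF assms(1), of \<alpha> \<gamma>] band_nonzero[OF assms(2), of \<gamma> \<beta>]
    show False by simp
  qed
qed

text \<open>All sums are taken over one finite degree ball and interchanged. The third factor is
  arbitrary, so moment matrices and transposes, whose rows may be infinite, can stand on the
  right.\<close>

lemma smult_assoc:
  assumes "band p A" "band r B"
  shows "A \<star> B \<star> C = A \<star> (B \<star> C)"
proof (intro ext)
  fix \<alpha> \<beta> :: "'a mindex"
  let ?F = "{\<gamma>. mdeg \<gamma> \<le> mdeg \<alpha> + p + r}"
  have "(A \<star> B \<star> C) \<alpha> \<beta> = (\<Sum>\<delta>\<in>?F. (\<Sum>\<gamma>\<in>?F. A \<alpha> \<gamma> * B \<gamma> \<delta>) * C \<delta> \<beta>)"
    by (simp add: smult_eq_sum_le[OF band_smult[OF assms], of _ "mdeg \<alpha> + p + r"]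
        smult_eq_sum_le[OF assms(1), of _ "mdeg \<alpha> + p + r"])
  also have "\<dots> = (\<Sum>\<delta>\<in>?F. \<Sum>\<gamma>\<in>?F. A \<alpha> \<gamma> * (B \<gamma> \<delta> * C \<delta> \<beta>))"
    by (simp add: sum_distrib_right mult.assoc)
  also have "\<dots> = (\<Sum>\<gamma>\<in>?F. A \<alpha> \<gamma> * (\<Sum>\<delta>\<in>?F. B \<gamma> \<delta> * C \<delta> \<beta>))"
    by (subst sum.swap) (simp add: sum_distrib_left)
  also have "\<dots> = (\<Sum>\<gamma>\<in>?F. A \<alpha> \<gamma> * (B \<star> C) \<gamma> \<beta>)"
  \<comment> \<open>Only \<open>\<gamma>\<close> with \<open>A \<alpha> \<gamma> \<noteq> 0\<close>
    matter. Their degree is at most \<open>mdeg \<alpha> + p\<close>, so the support of row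
    \<open>\<gamma>\<close> of \<open>B\<close> lies inside \<open>?F\<close>.\<close>
  proof (rule sum.cong[OF refl])
    fix \<gamma>
    show "A \<alpha> \<gamma> * (\<Sum>\<delta>\<in>?F. B \<gamma> \<delta> * C \<delta> \<beta>) = A \<alpha> \<gamma> * (B \<star> C) \<gamma> \<beta>"
    proof (cases "A \<alpha> \<gamma> = 0")
      case False
      then have "mdeg \<gamma> \<le> mdeg \<alpha> + p" by (rule band_nonzero[OF assms(1)])
      then show ?thesis by (simp add: smult_eq_sum_le[OF assms(2), of _ "mdeg \<alpha> + p + r"])
    qed simp
  qed
  also have "\<dots> = (A \<star> (B \<star> C)) \<alpha> \<beta>"
    by (simp add: smult_eq_sum_le[OF assms(1), of _ "mdeg \<alpha> + p + r"])
  finally show "(A \<star> B \<star> C) \<alpha> \<beta> = (A \<star> (B \<star> C)) \<alpha> \<beta>" .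
qed

lemma band_sone: "band 0 sone"
  by (auto simp: band_def sone_def)

lemma sone_smult:
  fixes A :: "'a::finite smat"
  shows "sone \<star> A = A"
proof (intro ext)
  fix \<alpha> \<beta> :: "'a mindex"
  show "(sone \<star> A) \<alpha> \<beta> = A \<alpha> \<beta>"
    by (subst smult_eq_sum[OF band_sone, of "{\<alpha>}"]) (auto simp: sone_def)
qed

lemma smult_sone: "band p A \<Longrightarrow> A \<star> sone = A"
proof (intro ext)
  fix \<alpha> \<beta> :: "'a mindex"
  assume "band p A"
  then show "(A \<star> sone) \<alpha> \<beta> = A \<alpha> \<beta>"
    by (subst smult_eq_sum[of p _ "{\<beta>}"]) (auto simp: sone_def)
qed

text \<open>The transpose of a banded matrix can have infinite rows, so on both sides the transposed
  matrix is the right factor. The rule later moves a right factor to the left, where it can be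
  cancelled.\<close>

lemma stransp_smult_stransp:
  assumes "band p A" "band r B"
  shows "stransp (A \<star> stransp B) = B \<star> stransp A"
proof (intro ext)
  fix \<alpha> \<beta> :: "'a mindex"
  let ?n = "max (mdeg \<alpha> + r) (mdeg \<beta> + p)"
  show "stransp (A \<star> stransp B) \<alpha> \<beta> = (B \<star> stransp A) \<alpha> \<beta>"
    by (simp add: stransp_def smult_eq_sum_le[OF assms(1), of _ ?n]
        smult_eq_sum_le[OF assms(2), of _ ?n] mult.commute)
qed

lemma stransp_stransp [simp]: "stransp (stransp A) = A"
  by (simp add: stransp_def)

section \<open>Block lower unitriangular matrices and their inverses\<close>

lemma band_unitriangular: "block_lower_unitriangular A \<Longrightarrow> band 0 A"
  by (simp add: block_lower_unitriangular_def band_def)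

text \<open>In a diagonal block a nonzero term needs
  \<open>mdeg \<beta> \<le> mdeg \<gamma> \<le> mdeg \<alpha>\<close>, hence equal degrees. There
  \<open>A\<close> is the identity, which leaves only \<open>\<gamma> = \<alpha>\<close>.\<close>

lemma unitriangular_smult:
  assumes "block_lower_unitriangular A" "block_lower_unitriangular B"
  shows "block_lower_unitriangular (A \<star> B)"
  unfolding block_lower_unitriangular_def
proof (intro conjI allI impI)
  note b = band_unitriangular[OF assms(1)] band_unitriangular[OF assms(2)]
  fix \<alpha> \<beta> :: "'a mindex"
  show "mdeg \<alpha> < mdeg \<beta> \<Longrightarrow> (A \<star> B) \<alpha> \<beta> = 0"
    using bandD[OF band_smult[OF b]] by simp
  assume eq: "mdeg \<alpha> = mdeg \<beta>"
  have "A \<alpha> \<gamma> * B \<gamma> \<beta> = 0" if "\<gamma> \<noteq> \<alpha>" for \<gamma>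
  proof (cases "mdeg \<gamma>" "mdeg \<alpha>" rule: linorder_cases)
    case less
    then show ?thesis using bandD[OF b(2), of \<gamma> \<beta>] eq by simp
  next
    case equal
    then have "A \<alpha> \<gamma> = sone \<alpha> \<gamma>" using assms(1) by (simp add: block_lower_unitriangular_def)
    then show ?thesis using that by (simp add: sone_def)
  next
    case greater
    then show ?thesis using bandD[OF b(1), of \<alpha> \<gamma>] by simp
  qed
  then have "(A \<star> B) \<alpha> \<beta> = A \<alpha> \<alpha> * B \<alpha> \<beta>"
    by (subst smult_eq_sum[OF b(1), of "{\<alpha>}"]) auto
  also have "\<dots> = sone \<alpha> \<beta>"
    using assms eq by (simp add: block_lower_unitriangular_def sone_def)
  finally show "(A \<star> B) \<alpha> \<beta> = sone \<alpha> \<beta>" .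
qed

text \<open>The inverse of \<open>1 - P\<close> with \<open>P\<close> strictly block lower triangular is the Neumann series
  of \<open>P\<close>, which is a finite sum in each entry.\<close>

lemma unitriangular_right_inverse:
  assumes "block_lower_unitriangular A"
  shows "\<exists>B. block_lower_unitriangular B \<and> A \<star> B = sone"
proof -
  define P where "P = (\<lambda>\<alpha> \<beta>. sone \<alpha> \<beta> - A \<alpha> \<beta>)"
  have P0: "P \<alpha> \<beta> = 0" if "mdeg \<alpha> \<le> mdeg \<beta>" for \<alpha> \<beta>
    using that assms by (cases "mdeg \<alpha> = mdeg \<beta>")
      (auto simp: P_def block_lower_unitriangular_def sone_def)
  then have bP: "band 0 P" by (simp add: band_def)
  define pw where "pw n = ((\<star>) P ^^ n) sone" for n
  have pw_Suc: "pw (Suc n) = P \<star> pw n" for n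
    by (simp add: pw_def)
  \<comment> \<open>Each factor \<open>P\<close> lowers the degree by at least one, so the
    \<open>n\<close>-th power lives at least \<open>n\<close> blocks below the diagonal.\<close>
  have pw0: "pw n \<alpha> \<beta> = 0" if "mdeg \<alpha> < mdeg \<beta> + n" for n \<alpha> \<beta>
    using that
  proof (induction n arbitrary: \<alpha>)
    case 0
    then show ?case by (auto simp: pw_def sone_def)
  next
    case (Suc n)
    show ?case
    proof (rule ccontr)
      assume "pw (Suc n) \<alpha> \<beta> \<noteq> 0"
      then obtain \<gamma> where g: "P \<alpha> \<gamma> \<noteq> 0" "pw n \<gamma> \<beta> \<noteq> 0"
        unfolding pw_Suc by (rule smult_nonzeroE)
      have "mdeg \<gamma> < mdeg \<alpha>" using P0[of \<alpha> \<gamma>] g(1) by (meson not_le)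
      then show False using Suc g(2) by simp
    qed
  qed
  define B where "B = (\<lambda>\<alpha> \<beta>. \<Sum>n\<le>mdeg \<alpha>. pw n \<alpha> \<beta>)"
  \<comment> \<open>Powers beyond \<open>mdeg \<alpha>\<close> vanish in row
    \<open>\<alpha>\<close>, so one cutoff \<open>k\<close> serves all rows up to degree
    \<open>k\<close>. This permits the interchange of sums below.\<close>
  have B_eq: "B \<alpha> \<beta> = (\<Sum>n\<le>k. pw n \<alpha> \<beta>)" if "mdeg \<alpha> \<le> k" for \<alpha> \<beta> k
    unfolding B_def using that pw0 by (intro sum.mono_neutral_left) auto
  have "block_lower_unitriangular B"
    unfolding block_lower_unitriangular_def
  proof (intro conjI allI impI)
    fix \<alpha> \<beta> :: "'a mindex"
    show "mdeg \<alpha> < mdeg \<beta> \<Longrightarrow> B \<alpha> \<beta> = 0"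
      by (simp add: B_def pw0)
    assume "mdeg \<alpha> = mdeg \<beta>"
    then have "B \<alpha> \<beta> = (\<Sum>n\<in>{0}. pw n \<alpha> \<beta>)"
      unfolding B_def using pw0 by (intro sum.mono_neutral_right) auto
    then show "B \<alpha> \<beta> = sone \<alpha> \<beta>" by (simp add: pw_def)
  qed
  moreover have "A \<star> B = sone"
  proof (intro ext)
    fix \<alpha> \<beta> :: "'a mindex"
    let ?F = "{\<gamma>. mdeg \<gamma> \<le> mdeg \<alpha>}"
    have "(A \<star> B) \<alpha> \<beta> = (\<Sum>\<gamma>\<in>?F. A \<alpha> \<gamma> * B \<gamma> \<beta>)"
      by (rule smult_eq_sum_le[OF band_unitriangular[OF assms]]) simp
    also have "\<dots> = (\<Sum>\<gamma>\<in>?F. sone \<alpha> \<gamma> * B \<gamma> \<beta>) - (\<Sum>\<gamma>\<in>?F. P \<alpha> \<gamma> * B \<gamma> \<beta>)"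
      by (simp add: P_def algebra_simps flip: sum_subtractf)
    also have "(\<Sum>\<gamma>\<in>?F. sone \<alpha> \<gamma> * B \<gamma> \<beta>) = B \<alpha> \<beta>"
      using smult_eq_sum_le[OF band_sone, of \<alpha> "mdeg \<alpha>" B \<beta>] by (simp add: sone_smult)
    also have "(\<Sum>\<gamma>\<in>?F. P \<alpha> \<gamma> * B \<gamma> \<beta>) = (\<Sum>\<gamma>\<in>?F. \<Sum>n\<le>mdeg \<alpha>. P \<alpha> \<gamma> * pw n \<gamma> \<beta>)"
      by (intro sum.cong[OF refl]) (simp add: B_eq[of _ "mdeg \<alpha>"] sum_distrib_left)
    also have "\<dots> = (\<Sum>n\<le>mdeg \<alpha>. \<Sum>\<gamma>\<in>?F. P \<alpha> \<gamma> * pw n \<gamma> \<beta>)"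
      by (rule sum.swap)
    also have "\<dots> = (\<Sum>n\<le>mdeg \<alpha>. pw (Suc n) \<alpha> \<beta>)"
      by (simp add: pw_Suc smult_eq_sum_le[OF bP, of _ "mdeg \<alpha>"])
    also have "B \<alpha> \<beta> - \<dots> = (\<Sum>n\<le>mdeg \<alpha>. pw n \<alpha> \<beta> - pw (Suc n) \<alpha> \<beta>)"
      by (simp add: B_def sum_subtractf)
    also have "\<dots> = pw 0 \<alpha> \<beta> - pw (Suc (mdeg \<alpha>)) \<alpha> \<beta>"
      by (rule sum_telescope)
    also have "\<dots> = sone \<alpha> \<beta>"
      using pw0[of \<alpha> \<beta> "Suc (mdeg \<alpha>)"] by (simp add: pw_def)
    finally show "(A \<star> B) \<alpha> \<beta> = sone \<alpha> \<beta>" .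
  qed
  ultimately show ?thesis by blast
qed

text \<open>A right inverse \<open>B\<close> of \<open>A\<close> has itself a right inverse
  \<open>C\<close>, and associativity forces \<open>C = A\<close>, so \<open>B\<close> is two-sided.
  Since \<open>sinv\<close> is a definite description, uniqueness among all semi-infinite matrices
  is shown as well.\<close>

lemma unitriangular_sinv:
  assumes "block_lower_unitriangular A"
  shows "block_lower_unitriangular (sinv A)" "A \<star> sinv A = sone" "sinv A \<star> A = sone"
proof -
  obtain B where B: "block_lower_unitriangular B" "A \<star> B = sone"
    using unitriangular_right_inverse[OF assms] by blast
  obtain C where C: "block_lower_unitriangular C" "B \<star> C = sone"
    using unitriangular_right_inverse[OF B(1)] by blast
  note b = assms[THEN band_unitriangular] B(1)[THEN band_unitriangular] C(1)[THEN band_unitriangular]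
  have "A = A \<star> (B \<star> C)" by (simp add: C(2) smult_sone[OF b(1)])
  also have "\<dots> = C" by (simp add: smult_assoc[OF b(1,2), symmetric] B(2) sone_smult)
  finally have BA: "B \<star> A = sone" using C(2) by simp
  have "sinv A = B"
    unfolding sinv_def
  proof (rule the_equality)
    fix X assume X: "A \<star> X = sone \<and> X \<star> A = sone"
    have "X = B \<star> A \<star> X" by (simp add: BA sone_smult)
    also have "\<dots> = B" using X by (simp add: smult_assoc[OF b(2,1)] smult_sone[OF b(2)])
    finally show "X = B" .
  qed (simp add: B BA)
  then show "block_lower_unitriangular (sinv A)" "A \<star> sinv A = sone" "sinv A \<star> A = sone"
    using B BA by simp_all
qed

section \<open>The triangular factors of the shifted Jacobi matrix\<close>

lemma band_block_diagonal: "block_diagonal A \<Longrightarrow> band 0 A"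
  by (simp add: block_diagonal_def band_def)

lemma block_diagonal_smult:
  assumes "block_diagonal A" "block_diagonal B"
  shows "block_diagonal (A \<star> B)"
  using assms unfolding block_diagonal_def by (metis smult_nonzeroE)

text \<open>\<open>G\<close> equates two expressions for the shifted moment matrix. Multiplying it
  by \<open>S'\<close> from the left and then removing the right factor
  \<open>stransp (sinv S)\<close> turns it into
  \<open>U \<star> H = H' \<star> stransp M\<close>.\<close>

lemma gauss_borel_shift:
  assumes S: "block_lower_unitriangular S" and S': "block_lower_unitriangular S'"
    and H: "block_diagonal H" and H': "block_diagonal H'"
    and L: "band 1 L"
    and G: "sinv S' \<star> H' \<star> stransp (sinv S') = L \<star> (sinv S \<star> H \<star> stransp (sinv S))"
  defines "M \<equiv> S \<star> sinv S'" and "U \<equiv> S' \<star> L \<star> sinv S"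
  shows "M \<star> U = S \<star> L \<star> sinv S" "U \<star> H = H' \<star> stransp M" "band 1 U" "block_lower_unitriangular M"
proof -
  note R = unitriangular_sinv[OF S] and R' = unitriangular_sinv[OF S']
  note bS = band_unitriangular[OF S] and bS' = band_unitriangular[OF S']
  note bR = band_unitriangular[OF R(1)] and bR' = band_unitriangular[OF R'(1)]
  note bH = band_block_diagonal[OF H] and bH' = band_block_diagonal[OF H']
  have bM: "band 0 M" unfolding M_def using band_smult[OF bS bR'] by simp
  show M: "block_lower_unitriangular M"
    unfolding M_def by (rule unitriangular_smult[OF S R'(1)])
  have bSL: "band 1 (S' \<star> L)" using band_smult[OF bS' L] by simp
  have bLR: "band 1 (L \<star> sinv S)" using band_smult[OF L bR] by simp
  show bU: "band 1 U" unfolding U_def using band_smult[OF bSL bR] by simp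
  have "M \<star> U = S \<star> (sinv S' \<star> (S' \<star> L \<star> sinv S))"
    unfolding M_def U_def by (rule smult_assoc[OF bS bR'])
  also have "\<dots> = S \<star> (L \<star> sinv S)"
    by (simp add: smult_assoc[OF bS' L] smult_assoc[OF bR' bS', symmetric] R' sone_smult)
  finally show "M \<star> U = S \<star> L \<star> sinv S" by (simp add: smult_assoc[OF bS L])
  have bUH: "band 1 (U \<star> H)" using band_smult[OF bU bH] by simp
  have "H' \<star> stransp (sinv S') = S' \<star> (sinv S' \<star> H' \<star> stransp (sinv S'))"
    by (simp add: smult_assoc[OF bR' bH'] smult_assoc[OF bS' bR', symmetric] R' sone_smult)
  also have "\<dots> = S' \<star> (L \<star> (sinv S \<star> H \<star> stransp (sinv S)))"
    by (simp only: G)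
  also have "\<dots> = U \<star> H \<star> stransp (sinv S)"
    by (simp add: smult_assoc[OF bU bH])
      (simp add: U_def smult_assoc[OF bS' L] smult_assoc[OF bS' bLR] smult_assoc[OF L bR]
        smult_assoc[OF bR bH])
  \<comment> \<open>The rows of \<open>stransp (sinv S)\<close> may be infinite, so reassociating
    does not cancel it on the right. After transposition \<open>sinv S\<close> stands on the left
    and is removed by \<open>S\<close>.\<close>
  finally have "stransp (H' \<star> stransp (sinv S')) = stransp (U \<star> H \<star> stransp (sinv S))"
    by (rule arg_cong)
  then have "sinv S' \<star> stransp H' = sinv S \<star> stransp (U \<star> H)"
    by (simp add: stransp_smult_stransp[OF bH' bR'] stransp_smult_stransp[OF bUH bR])
  then have "S \<star> (sinv S' \<star> stransp H') = stransp (U \<star> H)"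
    by (simp add: smult_assoc[OF bS bR, symmetric] R sone_smult)
  then have "M \<star> stransp H' = stransp (U \<star> H)"
    by (simp add: M_def smult_assoc[OF bS bR'])
  then show "U \<star> H = H' \<star> stransp M"
    using stransp_smult_stransp[OF bM bH'] by (metis stransp_stransp)
qed

text \<open>\<open>U\<close> equals \<open>H' \<star> stransp M \<star> Hi\<close>, built from block
  diagonal and block upper triangular factors. A nonzero entry would give intermediate labels with
  \<open>mdeg \<alpha> = mdeg \<delta> \<le> mdeg \<gamma> = mdeg \<beta>\<close>.\<close>

lemma upper_factor_zero:
  assumes "block_lower_unitriangular M" "band 1 U" "block_diagonal H" "block_diagonal H'"
    "block_diagonal Hi" "H \<star> Hi = sone"
    and UH: "U \<star> H = H' \<star> stransp M" and "mdeg \<beta> < mdeg \<alpha>"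
  shows "U \<alpha> \<beta> = 0"
proof (rule ccontr)
  assume nz: "U \<alpha> \<beta> \<noteq> 0"
  have "U = U \<star> H \<star> Hi"
    by (simp add: smult_assoc[OF assms(2) band_block_diagonal[OF assms(3)]] assms(6) smult_sone[OF assms(2)])
  then have "(H' \<star> stransp M \<star> Hi) \<alpha> \<beta> \<noteq> 0" using nz UH by simp
  then obtain \<gamma> where \<gamma>: "(H' \<star> stransp M) \<alpha> \<gamma> \<noteq> 0" "Hi \<gamma> \<beta> \<noteq> 0" by (rule smult_nonzeroE)
  from \<gamma>(1) obtain \<delta> where "H' \<alpha> \<delta> \<noteq> 0" "stransp M \<delta> \<gamma> \<noteq> 0" by (rule smult_nonzeroE)
  then have "mdeg \<alpha> = mdeg \<delta>" "mdeg \<delta> \<le> mdeg \<gamma>" "mdeg \<gamma> = mdeg \<beta>"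
    using assms(4,5) \<gamma>(2) band_nonzero[OF band_unitriangular[OF assms(1)], of \<gamma> \<delta>]
    by (auto simp: block_diagonal_def stransp_def)
  then show False using assms(8) by simp
qed

text \<open>Solving for \<open>stransp M\<close> gives \<open>Hi' \<star> (U \<star> H)\<close>, and
  block diagonal factors do not widen the single block superdiagonal of \<open>U\<close>.\<close>

lemma lower_factor_zero:
  assumes M: "block_lower_unitriangular M" and U: "band 1 U" and H: "block_diagonal H"
    and H': "block_diagonal H'" and Hi: "block_diagonal Hi'" and inv: "Hi' \<star> H' = sone"
    and UH: "U \<star> H = H' \<star> stransp M" and deg: "mdeg \<beta> + 1 < mdeg \<alpha>"
  shows "M \<alpha> \<beta> = 0"
proof -
  note b = band_block_diagonal[OF Hi] band_block_diagonal[OF H']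
  have "stransp M = Hi' \<star> (U \<star> H)"
    by (simp add: UH inv sone_smult smult_assoc[OF b, symmetric])
  moreover have "band 1 (Hi' \<star> (U \<star> H))"
    using band_smult[OF b(1) band_smult[OF U band_block_diagonal[OF H]]] by simp
  ultimately show ?thesis
    using bandD[of 1 "stransp M" \<beta> \<alpha>] deg by (simp add: stransp_def)
qed

section \<open>The shift of the moment matrix\<close>

lemma closed_measure_support: "closed (measure_support M)"
proof -
  have "- measure_support M = \<Union>{U. open U \<and> emeasure M U = 0}"
    by (auto simp: measure_support_def zero_less_iff_neq_zero)
  then show ?thesis unfolding closed_def by auto
qed

text \<open>The complement of the support is a union of open null sets. By the Lindelof property
  countably many of them cover it, so it is null.\<close>

lemma AE_measure_support:
  fixes M :: "'a::second_countable_topology measure"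
  assumes "sets M = sets borel"
  shows "AE x in M. x \<in> measure_support M"
proof -
  let ?\<U> = "{U. open U \<and> emeasure M U = 0}"
  obtain \<V> where \<V>: "\<V> \<subseteq> ?\<U>" "countable \<V>" "\<Union>\<V> = \<Union>?\<U>"
    using Lindelof[of ?\<U>] by blast
  have "V \<in> null_sets M" if "V \<in> \<V>" for V
    using that \<V>(1) assms by (auto simp: null_sets_def)
  then have "\<Union>?\<U> \<in> null_sets M"
    using null_sets_UN'[OF \<V>(2), of id M] \<V>(3) by simp
  moreover have "{x \<in> space M. x \<notin> measure_support M} \<subseteq> \<Union>?\<U>"
    by (auto simp: measure_support_def zero_less_iff_neq_zero)
  ultimately show ?thesis by (rule AE_I')
qed

lemma integrable_compact_support:
  fixes f :: "'a::{second_countable_topology,t2_space} \<Rightarrow> real"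
  assumes "sets M = sets borel" "finite_measure M" "compact (measure_support M)"
    and "continuous_on (measure_support M) f" "f \<in> borel_measurable M"
  shows "integrable M f"
proof -
  obtain B where B: "\<And>x. x \<in> measure_support M \<Longrightarrow> norm (f x) \<le> B"
    using compact_imp_bounded[OF compact_continuous_image[OF assms(4,3)]]
    by (auto simp: bounded_iff)
  have "AE x in M. norm (f x) \<le> B"
    using AE_measure_support[OF assms(1)] by eventually_elim (rule B)
  then show ?thesis
    using assms(2,5) by (intro finite_measure.integrable_const_bound)
qed

text \<open>The closed support is bounded because it lies in the image of a box under the inverse of
  \<open>N\<close>.\<close>

lemma compact_parallelepiped_support:
  fixes N :: "real ^ 'd ^ 'd"
  assumes "invertible N" "measure_support M \<subseteq> {x. \<forall>a. \<bar>inner (N $ a) x\<bar> < c $ a}"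
  shows "compact (measure_support M)"
proof -
  obtain A where A: "A ** N = Finite_Cartesian_Product.mat 1"
    using assms(1) by (auto simp: invertible_def)
  have "x \<in> (*v) A ` cbox (- c) c" if "x \<in> measure_support M" for x
  proof
    show "x = A *v (N *v x)" by (simp add: matrix_vector_mul_assoc A)
    have "\<bar>inner (N $ a) x\<bar> \<le> c $ a" for a
      using subsetD[OF assms(2) that] by (auto intro: less_imp_le)
    then show "N *v x \<in> cbox (- c) c"
      by (auto simp: mem_box_cart matrix_vector_mul_component abs_le_iff) (smt (verit) abs_le_iff)
  qed
  moreover have "bounded ((*v) A ` cbox (- c) c)"
    by (intro compact_imp_bounded compact_continuous_image compact_cbox
        matrix_vector_mult_linear_continuous_on)
  ultimately show ?thesis
    by (meson bounded_subset closed_measure_support compact_eq_bounded_closed subsetI)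
qed

section \<open>Monomials, flow weights and the action of the shift on moments\<close>

lemma continuous_on_monomial: "continuous_on X (monomial \<alpha>)"
  unfolding monomial_def by (intro continuous_intros)

lemma continuous_on_flow_weight:
  assumes "\<And>x a. x \<in> X \<Longrightarrow> inner (N $ a) x \<noteq> q $ a"
  shows "continuous_on X (flow_weight N q m)"
  unfolding flow_weight_def using assms by (intro continuous_intros) auto

lemma borel_measurable_flow_weight: "flow_weight N q m \<in> borel_measurable borel"
proof -
  have "(\<lambda>x. (inner (N $ a) x - q $ a) powi (m $ a)) \<in> borel_measurable borel" for a
    by (cases "m $ a \<ge> 0") (simp_all add: power_int_def)
  then show ?thesis unfolding flow_weight_def by measurable
qed

lemma monomial_Suc: "monomial (\<alpha>(b := \<alpha> b + 1)) x = x $ b * monomial \<alpha> x"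
proof -
  have "monomial (\<alpha>(b := \<alpha> b + 1)) x = (x $ b) ^ (\<alpha> b + 1) * (\<Prod>i\<in>UNIV - {b}. (x $ i) ^ \<alpha> i)"
    unfolding monomial_def by (subst prod.remove[of _ b]) (auto intro!: prod.cong)
  also have "\<dots> = x $ b * monomial \<alpha> x"
    unfolding monomial_def by (subst (2) prod.remove[of _ b]) auto
  finally show ?thesis .
qed

text \<open>The hyperplane is excluded because the addition law of \<open>powi\<close> fails at base
  0 when the exponent goes from -1 to 0.\<close>

lemma flow_weight_shift:
  assumes "inner (N $ a) x \<noteq> q $ a"
  shows "flow_weight N q (m + axis a 1) x = (inner (N $ a) x - q $ a) * flow_weight N q m x"
proof -
  let ?w = "\<lambda>m i. (inner (N $ i) x - q $ i) powi (m $ i)"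
  have "flow_weight N q (m + axis a 1) x = ?w (m + axis a 1) a * (\<Prod>i\<in>UNIV - {a}. ?w m i)"
    unfolding flow_weight_def
    by (subst prod.remove[of _ a]) (auto intro!: prod.cong simp: axis_def)
  also have "?w (m + axis a 1) a = (inner (N $ a) x - q $ a) * ?w m a"
    using assms by (simp add: power_int_add axis_def)
  also have "(inner (N $ a) x - q $ a) * ?w m a * (\<Prod>i\<in>UNIV - {a}. ?w m i)
      = (inner (N $ a) x - q $ a) * flow_weight N q m x"
    unfolding flow_weight_def by (subst (2) prod.remove[of _ a]) auto
  finally show ?thesis .
qed

text \<open>This is the operator \<open>L\<close> of the overview. On the column of monomials it
  acts as multiplication by the linear function \<open>inner n x - c\<close>.\<close>

definition dir_shift :: "real ^ 'd \<Rightarrow> real \<Rightarrow> 'd::finite smat" where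
  "dir_shift n c = (\<lambda>\<alpha> \<beta>. (\<Sum>b\<in>UNIV. n $ b * shift_mat b \<alpha> \<beta>) - c * sone \<alpha> \<beta>)"

lemma mdeg_upd_Suc: "mdeg (\<alpha>(b := Suc (\<alpha> b))) = Suc (mdeg \<alpha>)"
  unfolding mdeg_def by (subst (1 2) sum.remove[of _ b]) (auto intro!: sum.cong)

lemma band_shift_mat: "band 1 (shift_mat b)"
  by (auto simp: band_def shift_mat_def mdeg_upd_Suc simp del: fun_upd_apply)

lemma band_dir_shift: "band 1 (dir_shift n c)"
  by (auto simp: band_def dir_shift_def bandD[OF band_shift_mat] sone_def)

lemma shift_mat_smult:
  fixes A :: "'a::finite smat"
  shows "(shift_mat b \<star> A) \<alpha> \<beta> = A (\<alpha>(b := \<alpha> b + 1)) \<beta>"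
  by (subst smult_eq_sum[OF band_shift_mat, of "{\<alpha>(b := \<alpha> b + 1)}"]) (auto simp: shift_mat_def)

lemma dir_shift_smult:
  "(dir_shift n c \<star> A) \<alpha> \<beta> = (\<Sum>b\<in>UNIV. n $ b * A (\<alpha>(b := \<alpha> b + 1)) \<beta>) - c * A \<alpha> \<beta>"
proof -
  let ?n = "mdeg \<alpha> + 1"
  have "(dir_shift n c \<star> A) \<alpha> \<beta> =
      (\<Sum>b\<in>UNIV. n $ b * (\<Sum>\<gamma> | mdeg \<gamma> \<le> ?n. shift_mat b \<alpha> \<gamma> * A \<gamma> \<beta>))
      - c * (\<Sum>\<gamma> | mdeg \<gamma> \<le> ?n. sone \<alpha> \<gamma> * A \<gamma> \<beta>)"
    unfolding smult_eq_sum_le[OF band_dir_shift le_refl]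
    by (simp add: dir_shift_def left_diff_distrib sum_subtractf sum_distrib_left
        sum_distrib_right sum.swap[of _ UNIV] mult.assoc)
  then show ?thesis
    using smult_eq_sum_le[OF band_shift_mat, of \<alpha> ?n _ A \<beta>]
      smult_eq_sum_le[OF band_sone, of \<alpha> ?n A \<beta>]
    by (simp add: shift_mat_smult sone_smult)
qed

text \<open>The new factor of the weight is absorbed into the monomial that labels the row. The
  integral may then be taken term by term, since every integrand is integrable.\<close>

lemma moment_matrix_shift:
  fixes N :: "real ^ 'd::finite ^ 'd" and \<mu> :: "(real ^ 'd) measure"
  assumes N: "invertible N" and borel: "sets \<mu> = sets borel" and fin: "integrable \<mu> (monomial (\<lambda>_. 0))"
    and supp: "measure_support \<mu> \<subseteq> {x. \<forall>a. \<bar>inner (N $ a) x\<bar> < \<bar>q $ a\<bar>}"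
  shows "moment_matrix \<mu> N q (m + axis a 1) = dir_shift (N $ a) (q $ a) \<star> moment_matrix \<mu> N q m"
proof (intro ext)
  fix \<alpha> \<beta> :: "'d mindex"
  \<comment> \<open>The monomial with zero exponents is the constant 1, so \<open>fin\<close> says
    that the measure is finite.\<close>
  have one: "monomial (\<lambda>_. 0) = (\<lambda>x :: real ^ 'd. 1)" by (simp add: monomial_def fun_eq_iff)
  have "finite_measure \<mu>"
    using fin unfolding one integrable_iff_bounded by (intro finite_measureI) auto
  have cpt: "compact (measure_support \<mu>)"
    by (rule compact_parallelepiped_support[OF N, where c = "\<chi> a. \<bar>q $ a\<bar>"]) (use supp in simp)
  have ne: "inner (N $ i) x \<noteq> q $ i" if "x \<in> measure_support \<mu>" for i x
    using subsetD[OF supp that] by (auto dest: spec[of _ i])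
  have [measurable]: "monomial \<delta> \<in> borel_measurable borel" for \<delta> :: "'d mindex"
    by (rule borel_measurable_continuous_onI) (rule continuous_on_monomial)
  note [measurable] = borel_measurable_flow_weight
  let ?f = "\<lambda>\<alpha> x. monomial \<alpha> x * monomial \<beta> x * flow_weight N q m x"
  \<comment> \<open>Negative exponents do no harm: the hyperplanes where a factor vanishes miss the
    support, so the integrand is continuous on this compact set.\<close>
  have int: "integrable \<mu> (?f \<gamma>)" for \<gamma>
  proof (rule integrable_compact_support[OF borel \<open>finite_measure \<mu>\<close> cpt])
    show "continuous_on (measure_support \<mu>) (?f \<gamma>)"
      using ne by (intro continuous_intros continuous_on_monomial continuous_on_flow_weight)
    show "?f \<gamma> \<in> borel_measurable \<mu>"
      by (subst measurable_cong_sets[OF borel refl]) measurable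
  qed
  have "moment_matrix \<mu> N q (m + axis a 1) \<alpha> \<beta>
      = (\<integral>x. (\<Sum>b\<in>UNIV. N $ a $ b * ?f (\<alpha>(b := \<alpha> b + 1)) x) - q $ a * ?f \<alpha> x \<partial>\<mu>)"
    unfolding moment_matrix_def
  proof (rule integral_cong_AE)
    show "AE x in \<mu>. monomial \<alpha> x * monomial \<beta> x * flow_weight N q (m + axis a 1) x
        = (\<Sum>b\<in>UNIV. N $ a $ b * ?f (\<alpha>(b := \<alpha> b + 1)) x) - q $ a * ?f \<alpha> x"
      using AE_measure_support[OF borel]
    proof eventually_elim
      case (elim x)
      have "(\<Sum>b\<in>UNIV. N $ a $ b * ?f (\<alpha>(b := \<alpha> b + 1)) x) = inner (N $ a) x * ?f \<alpha> x"
        by (simp only: monomial_Suc inner_vec_def sum_distrib_right) (simp add: mult_ac)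
      then show ?case
        by (simp add: flow_weight_shift[OF ne[OF elim]] algebra_simps)
    qed
  qed (subst measurable_cong_sets[OF borel refl], measurable)+
  also have "\<dots> = (dir_shift (N $ a) (q $ a) \<star> moment_matrix \<mu> N q m) \<alpha> \<beta>"
    unfolding dir_shift_smult moment_matrix_def
    by (simp add: Bochner_Integration.integral_diff integrable_diff integral_sum integrable_sum
        int integrable_mult_right del: fun_upd_apply)
  finally show "moment_matrix \<mu> N q (m + axis a 1) \<alpha> \<beta>
      = (dir_shift (N $ a) (q $ a) \<star> moment_matrix \<mu> N q m) \<alpha> \<beta>" .
qed

text \<open>Conjugation by \<open>S\<close> is linear in the middle factor and fixes multiples of
  the identity. As \<open>dir_jacobi\<close> is an entrywise sum, linearity is verified entrywise
  over the finite row of \<open>S\<close>.\<close>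

lemma dir_jacobi_eq:
  assumes S: "block_lower_unitriangular S"
  shows "S \<star> dir_shift n c \<star> sinv S = (\<lambda>\<alpha> \<beta>. dir_jacobi n S \<alpha> \<beta> - c * sone \<alpha> \<beta>)"
proof (intro ext)
  fix \<alpha> \<beta> :: "'a mindex"
  note bS = band_unitriangular[OF S]
  let ?F = "{\<gamma>. mdeg \<gamma> \<le> mdeg \<alpha>}"
  have *: "(S \<star> X \<star> sinv S) \<alpha> \<beta> = (\<Sum>\<gamma>\<in>?F. S \<alpha> \<gamma> * (X \<star> sinv S) \<gamma> \<beta>)" if "band r X" for X r
    by (simp add: smult_assoc[OF bS that] smult_eq_sum_le[OF bS, of _ "mdeg \<alpha>"])
  have "(S \<star> dir_shift n c \<star> sinv S) \<alpha> \<beta> = (\<Sum>b\<in>UNIV. n $ b * jacobi S b \<alpha> \<beta>)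
      - c * (S \<star> sone \<star> sinv S) \<alpha> \<beta>"
    unfolding jacobi_def *[OF band_dir_shift] *[OF band_shift_mat] *[OF band_sone]
    by (simp add: dir_shift_smult shift_mat_smult sone_smult right_diff_distrib sum_subtractf
        sum_distrib_left sum.swap[of _ UNIV] mult.left_commute del: fun_upd_apply)
  then show "(S \<star> dir_shift n c \<star> sinv S) \<alpha> \<beta> = dir_jacobi n S \<alpha> \<beta> - c * sone \<alpha> \<beta>"
    by (simp add: dir_jacobi_def smult_sone[OF bS] unitriangular_sinv[OF S])
qed

section \<open>Blocks, truncations and quasi-determinants\<close>

text \<open>The reversed lexicographic order is linear on multi-indices, and a finite set has
  exactly one strictly sorted list. Hence the definite description in \<open>mlist\<close> is
  proper.\<close>

lemma mlist_spec: "sorted_wrt (\<lambda>\<alpha> \<beta>. less_fun \<beta> \<alpha>) (mlist k :: 'd::{finite,linorder} mindex list)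
    \<and> set (mlist k :: 'd mindex list) = mindices k"
  and distinct_mlist: "distinct (mlist k :: 'd::{finite,linorder} mindex list)"
proof -
  define lt where "lt = (\<lambda>f g :: 'd mindex. less_fun g f)"
  define le where "le = (\<lambda>f g. lt f g \<or> f = g)"
  interpret lex: linorder le lt
  proof
    fix f g h :: "'d mindex"
    show "lt f g \<longleftrightarrow> le f g \<and> \<not> le g f"
      using less_fun_asym[of f g] less_fun_irrefl[of f] by (auto simp: le_def lt_def)
    show "le f g \<or> le g f"
      using less_fun_trichotomy[of f g] by (auto simp: le_def lt_def)
    show "le f g \<Longrightarrow> le g h \<Longrightarrow> le f h"
      using less_fun_trans[of h g f] by (auto simp: le_def lt_def)
    show "le f g \<Longrightarrow> le g f \<Longrightarrow> f = g"
      using less_fun_asym[of f g] by (auto simp: le_def lt_def)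
  qed (simp add: le_def)
  obtain xs where xs: "sorted_wrt lt xs" "set xs = mindices k"
    using lex.finite_set_strict_sorted[OF finite_mindices[of k]] by metis
  have "\<exists>!xs. sorted_wrt lt xs \<and> set xs = mindices k"
    using xs lex.strict_sorted_equal by metis
  from theI'[OF this] have *: "sorted_wrt lt (mlist k) \<and> set (mlist k :: 'd mindex list) = mindices k"
    unfolding mlist_def lt_def .
  then show "sorted_wrt (\<lambda>\<alpha> \<beta>. less_fun \<beta> \<alpha>) (mlist k :: 'd mindex list)
      \<and> set (mlist k :: 'd mindex list) = mindices k"
    unfolding lt_def .
  show "distinct (mlist k :: 'd mindex list)"
    using * lex.strict_sorted_iff by metis
qed

lemma set_mlist: "set (mlist k) = mindices k"
  by (simp add: mlist_spec)

lemma length_mlist: "length (mlist k :: 'd::{finite,linorder} mindex list) = card (mindices k :: 'd mindex set)"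
  by (metis distinct_card[OF distinct_mlist] set_mlist)

lemma mlist_upto_Suc: "mlist_upto (Suc k) = mlist_upto k @ mlist k"
  by (simp add: mlist_upto_def)

lemma set_mlist_upto: "set (mlist_upto l) = {\<alpha>. mdeg \<alpha> < l}"
  by (induction l) (auto simp: mlist_upto_Suc set_mlist mindices_def, simp add: mlist_upto_def)

lemma distinct_mlist_upto: "distinct (mlist_upto l)"
  by (induction l)
    (auto simp: mlist_upto_Suc distinct_mlist set_mlist set_mlist_upto mindices_def, simp add: mlist_upto_def)

section \<open>Finite submatrices of semi-infinite matrices\<close>

lemma submat_carrier [simp]: "submat A xs ys \<in> carrier_mat (length xs) (length ys)"
  by (simp add: submat_def)

lemma dim_submat [simp]: "dim_row (submat A xs ys) = length xs" "dim_col (submat A xs ys) = length ys"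
  by (simp_all add: submat_def)

lemma submat_eq_iff:
  "submat A xs ys = submat B xs ys \<longleftrightarrow> (\<forall>\<alpha>\<in>set xs. \<forall>\<beta>\<in>set ys. A \<alpha> \<beta> = B \<alpha> \<beta>)"
  by (auto simp: submat_def mat_eq_iff all_set_conv_all_nth)

lemma submat_sone: "distinct xs \<Longrightarrow> submat sone xs xs = 1\<^sub>m (length xs)"
  by (rule eq_matI) (auto simp: submat_def sone_def nth_eq_iff_index_eq)

lemma submat_stransp: "submat (stransp A) xs ys = transpose_mat (submat A ys xs)"
  by (rule eq_matI) (auto simp: submat_def stransp_def)

lemma submat_mult:
  assumes "distinct ys"
  shows "submat A xs ys * submat B ys zs = submat (\<lambda>\<alpha> \<beta>. \<Sum>\<gamma>\<in>set ys. A \<alpha> \<gamma> * B \<gamma> \<beta>) xs zs"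
  by (rule eq_matI)
    (auto simp: submat_def scalar_prod_def sum.distinct_set_conv_list[OF assms] sum_list_sum_nth)

lemma submat_mult_append:
  assumes "distinct (ys @ zs)"
  shows "submat A xs (ys @ zs) * submat B (ys @ zs) ws
    = submat A xs ys * submat B ys ws + submat A xs zs * submat B zs ws"
  using assms by (simp only: submat_mult distinct_append set_append)
    (auto intro!: eq_matI simp: submat_def sum.union_disjoint)

text \<open>This is the passage from \<open>\<star>\<close> to finite matrix products: it is valid
  once the middle list \<open>ys\<close> catches every nonzero term.\<close>

lemma submat_smult:
  assumes "band p A" "distinct ys"
    and "\<And>\<alpha> \<beta> \<gamma>. \<alpha> \<in> set xs \<Longrightarrow> \<beta> \<in> set zs \<Longrightarrow> \<gamma> \<notin> set ys \<Longrightarrow> A \<alpha> \<gamma> * B \<gamma> \<beta> = 0"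
  shows "submat (A \<star> B) xs zs = submat A xs ys * submat B ys zs"
  using assms by (auto simp: submat_mult submat_eq_iff intro!: smult_eq_sum)

text \<open>Carries a finite matrix, such as the inverse of a diagonal block, back to multi-index
  labels.\<close>

lemma submat_surj:
  assumes "distinct xs" "distinct ys" "X \<in> carrier_mat (length xs) (length ys)"
  shows "\<exists>A. submat A xs ys = X"
proof
  let ?i = "\<lambda>xs. the_inv_into {..<length xs} ((!) xs)"
  have "?i zs (zs ! j) = j" if "distinct zs" "j < length zs" for zs :: "'a mindex list" and j
    using that by (intro the_inv_into_f_f) (auto intro: inj_on_nth)
  then show "submat (\<lambda>\<alpha> \<beta>. X $$ (?i xs \<alpha>, ?i ys \<beta>)) xs ys = X"
    using assms by (intro eq_matI) (auto simp: submat_def)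
qed

lemma split_block_submat:
  "split_block (submat A (xs @ ys) (zs @ ws)) (length xs) (length zs)
    = (submat A xs zs, submat A xs ws, submat A ys zs, submat A ys ws)"
  unfolding split_block_def Let_def by (auto intro!: eq_matI simp: submat_def nth_append)

section \<open>Finite inverses, Schur complements and block LU factorizations\<close>

lemma invertible_matI:
  fixes A :: "'a::field Matrix.mat"
  assumes "A \<in> carrier_mat n n" "B \<in> carrier_mat n n" "A * B = 1\<^sub>m n"
  shows "invertible_mat A"
  using assms mat_mult_left_right_inverse[OF assms]
  by (auto simp: invertible_mat_def inverts_mat_def intro!: exI[of _ B])

lemma invertible_matE:
  assumes "invertible_mat A" "A \<in> carrier_mat n n"
  obtains B where "B \<in> carrier_mat n n" "A * B = 1\<^sub>m n" "B * A = 1\<^sub>m n"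
proof -
  obtain B where B: "A * B = 1\<^sub>m (dim_row A)" "B * A = 1\<^sub>m (dim_row B)"
    using assms(1) by (auto simp: invertible_mat_def inverts_mat_def)
  have "B \<in> carrier_mat n n"
    using assms(2) arg_cong[OF B(1), of dim_col] arg_cong[OF B(2), of dim_col] by auto
  with B assms(2) show thesis by (intro that[of B]) auto
qed

lemma invertible_mat_mult:
  fixes A :: "'a::field Matrix.mat"
  assumes "A \<in> carrier_mat n n" "B \<in> carrier_mat n n" "invertible_mat A" "invertible_mat B"
  shows "invertible_mat (A * B)"
proof -
  obtain A' where A': "A' \<in> carrier_mat n n" "A * A' = 1\<^sub>m n" by (rule invertible_matE[OF assms(3,1)])
  obtain B' where B': "B' \<in> carrier_mat n n" "B * B' = 1\<^sub>m n" by (rule invertible_matE[OF assms(4,2)])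
  have "(A * B) * (B' * A') = A * ((B * B') * A')"
    using assms(1,2) A'(1) B'(1) by (simp add: assoc_mult_mat[of _ n n _ n _ n])
  then have "(A * B) * (B' * A') = 1\<^sub>m n" using A' B' by simp
  then show ?thesis using assms(1,2) A'(1) B'(1) by (intro invertible_matI) auto
qed

lemma invertible_mat_left_factor:
  fixes A :: "'a::field Matrix.mat"
  assumes "A \<in> carrier_mat n n" "B \<in> carrier_mat n n" "invertible_mat (A * B)"
  shows "invertible_mat A"
proof -
  obtain C where "C \<in> carrier_mat n n" "A * B * C = 1\<^sub>m n"
    by (rule invertible_matE[OF assms(3), of n]) (use assms in auto)
  then show ?thesis
    using assms by (intro invertible_matI[of A n "B * C"]) (auto simp: assoc_mult_mat[of _ n n _ n _ n])
qed

lemma invertible_transpose_mat: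
  fixes A :: "'a::field Matrix.mat"
  assumes "A \<in> carrier_mat n n" "invertible_mat A"
  shows "invertible_mat (transpose_mat A)"
proof -
  obtain B where B: "B \<in> carrier_mat n n" "B * A = 1\<^sub>m n"
    by (rule invertible_matE[OF assms(2,1)])
  have "transpose_mat A * transpose_mat B = 1\<^sub>m n"
    using transpose_mult[OF B(1) assms(1)] B(2) by simp
  then show ?thesis using assms(1) B(1) by (intro invertible_matI[of _ n "transpose_mat B"]) auto
qed

lemma minv_inverse:
  assumes "A \<in> carrier_mat n n" "invertible_mat A"
  shows "minv A \<in> carrier_mat n n" "A * minv A = 1\<^sub>m n" "minv A * A = 1\<^sub>m n"
proof -
  obtain B where "B \<in> carrier_mat n n" "A * B = 1\<^sub>m n" "B * A = 1\<^sub>m n"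
    by (rule invertible_matE[OF assms(2,1)])
  then have "A \<in> Units (ring_mat TYPE(real) n ())"
    using assms(1) by (auto simp: Units_def ring_mat_def)
  then obtain C where "mat_inverse A = Some C"
    using mat_inverse(1)[OF assms(1), where b = "()"] by (cases "mat_inverse A") auto
  with mat_inverse(2)[OF assms(1) this]
  show "minv A \<in> carrier_mat n n" "A * minv A = 1\<^sub>m n" "minv A * A = 1\<^sub>m n"
    by (auto simp: minv_def)
qed

lemma eq_mult_minv:
  assumes "A \<in> carrier_mat n n" "invertible_mat A" "X \<in> carrier_mat r n" "X * A = Y"
  shows "Y * minv A = X"
  using assms minv_inverse[OF assms(1,2)] by (auto simp: assoc_mult_mat[of X r n A n _ n])

text \<open>\<open>P * V\<close>, \<open>Q * V\<close> and \<open>P * W\<close> are the blocks of an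
  LU product. First \<open>Q * V * minv (P * V)\<close> reduces to \<open>Q * minv P\<close>, then
  \<open>minv P\<close> cancels the \<open>P\<close> of \<open>P * W\<close>.\<close>

lemma schur_correction_LU:
  assumes P: "P \<in> carrier_mat n n" "invertible_mat P" and V: "V \<in> carrier_mat n n" "invertible_mat V"
    and Q: "Q \<in> carrier_mat s n" and W: "W \<in> carrier_mat n r"
  shows "Q * V * minv (P * V) * (P * W) = Q * W"
proof -
  note i = minv_inverse[OF P]
  have cancel: "Q * minv P * (P * Z) = Q * Z" if "Z \<in> carrier_mat n t" for Z t
  proof -
    have "Q * minv P * (P * Z) = Q * (minv P * P * Z)"
      using Q i(1) P(1) that by (simp add: assoc_mult_mat[of _ s n _ n _ t] assoc_mult_mat[of _ n n _ n _ t])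
    then show ?thesis using i(3) that by simp
  qed
  have "Q * V * minv (P * V) = Q * minv P"
    using P V Q i(1) by (intro eq_mult_minv[of _ n _ s] invertible_mat_mult[of _ n] cancel[of _ n]) auto
  then show ?thesis using cancel[OF W] by simp
qed

text \<open>Here \<open>xs\<close> labels the leading part and \<open>ys\<close> the last block. The
  last diagonal block of \<open>K\<close> is the Schur correction plus the last block of
  \<open>U\<close>, so subtracting the correction leaves that block.\<close>

lemma last_quasidet_LU:
  fixes K M U :: "'d smat"
  assumes dist: "distinct (xs @ ys)"
    and K: "\<And>\<alpha> \<beta>. \<alpha> \<in> set (xs @ ys) \<Longrightarrow> \<beta> \<in> set (xs @ ys) \<Longrightarrow>
      K \<alpha> \<beta> = (\<Sum>\<gamma>\<in>set (xs @ ys). M \<alpha> \<gamma> * U \<gamma> \<beta>)"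
    and M: "\<And>\<alpha> \<beta>. \<alpha> \<in> set xs \<Longrightarrow> \<beta> \<in> set ys \<Longrightarrow> M \<alpha> \<beta> = 0"
    and U: "\<And>\<alpha> \<beta>. \<alpha> \<in> set xs \<Longrightarrow> \<beta> \<in> set ys \<Longrightarrow> U \<beta> \<alpha> = 0"
    and M1: "\<And>\<alpha> \<beta>. \<alpha> \<in> set ys \<Longrightarrow> \<beta> \<in> set ys \<Longrightarrow> M \<alpha> \<beta> = sone \<alpha> \<beta>"
    and inv: "invertible_mat (submat M xs xs)" "invertible_mat (submat U xs xs)"
  shows "last_quasidet_exists (length ys) (submat K (xs @ ys) (xs @ ys))"
    and "last_quasidet (length ys) (submat K (xs @ ys) (xs @ ys)) = submat U ys ys"
proof -
  let ?n = "length xs" and ?s = "length ys"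
  have K': "submat K zs ws = submat M zs xs * submat U xs ws + submat M zs ys * submat U ys ws"
    if "set zs \<subseteq> set (xs @ ys)" "set ws \<subseteq> set (xs @ ys)" for zs ws
  proof -
    have "submat K zs ws = submat M zs (xs @ ys) * submat U (xs @ ys) ws"
      using that by (auto simp: submat_mult[OF dist] submat_eq_iff simp del: set_append intro!: K)
    then show ?thesis by (simp only: submat_mult_append[OF dist])
  qed
  have Mxy: "submat M xs ys = 0\<^sub>m ?n ?s" and Uyx: "submat U ys xs = 0\<^sub>m ?s ?n"
    using M U by (auto intro!: eq_matI simp: submat_def)
  have Myy: "submat M ys ys = 1\<^sub>m ?s"
    using M1 dist by (simp add: submat_eq_iff flip: submat_sone)
  have Kxx: "submat K xs xs = submat M xs xs * submat U xs xs"
    and Kxy: "submat K xs ys = submat M xs xs * submat U xs ys"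
    and Kyx: "submat K ys xs = submat M ys xs * submat U xs xs"
    and Kyy: "submat K ys ys = submat M ys xs * submat U xs ys + submat U ys ys"
    by (auto simp: K' Mxy Uyx Myy right_mult_zero_mat[of _ ?s ?s] left_mult_zero_mat[of _ ?s]
       intro!: eq_matI)
  have inv_K: "invertible_mat (submat K xs xs)"
    unfolding Kxx by (rule invertible_mat_mult[of _ ?n]) (use inv in auto)
  then show "last_quasidet_exists ?s (submat K (xs @ ys) (xs @ ys))"
    by (simp add: last_quasidet_exists_def split_block_submat)
  have "submat K ys xs * minv (submat K xs xs) * submat K xs ys = submat M ys xs * submat U xs ys"
    unfolding Kxx Kxy Kyx by (rule schur_correction_LU[of _ ?n _ _ ?s]) (use inv in auto)
  then have schur: "submat K ys ys - submat K ys xs * minv (submat K xs xs) * submat K xs ys = submat U ys ys"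
    by (auto simp: Kyy intro!: eq_matI)
  show "last_quasidet ?s (submat K (xs @ ys) (xs @ ys)) = submat U ys ys"
  \<comment> \<open>Without a leading part the quasi-determinant is by definition the matrix itself.
    The correction is then a product over an empty index range, hence zero.\<close>
  proof (cases "xs = []")
    case True
    then have "submat M ys xs * submat U xs ys = 0\<^sub>m ?s ?s"
      by (auto intro!: eq_matI simp: submat_def scalar_prod_def)
    then show ?thesis using True Kyy by (simp add: last_quasidet_def)
  qed (simp add: last_quasidet_def split_block_submat schur)
qed

text \<open>The diagonal blocks are inverted one by one, and the inverses are glued into one
  semi-infinite matrix that vanishes off the diagonal blocks.\<close>

lemma block_diagonal_inverse:
  fixes H :: "'d::{finite,linorder} smat"
  assumes H: "block_diagonal H" and inv: "\<And>k. invertible_mat (block H k k)"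
  shows "\<exists>B. block_diagonal B \<and> H \<star> B = sone \<and> B \<star> H = sone"
proof -
  have "\<exists>A :: 'd smat. block H k k * block A k k = 1\<^sub>m (length (mlist k :: 'd mindex list)) \<and>
      block A k k * block H k k = 1\<^sub>m (length (mlist k :: 'd mindex list))" for k
  proof -
    have "invertible_mat (submat H (mlist k) (mlist k))" using inv[of k] by (simp add: block_def)
    then obtain X where X: "X \<in> carrier_mat (length (mlist k :: 'd mindex list)) (length (mlist k :: 'd mindex list))"
      "submat H (mlist k) (mlist k) * X = 1\<^sub>m (length (mlist k :: 'd mindex list))"
      "X * submat H (mlist k) (mlist k) = 1\<^sub>m (length (mlist k :: 'd mindex list))"
      by (rule invertible_matE[OF _ submat_carrier])
    obtain A where "submat A (mlist k) (mlist k :: 'd mindex list) = X"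
      using submat_surj[OF distinct_mlist distinct_mlist X(1)] by blast
    with X show ?thesis unfolding block_def by blast
  qed
  then obtain A :: "nat \<Rightarrow> 'd smat" where A: "\<And>k. block H k k * block (A k) k k = 1\<^sub>m (length (mlist k :: 'd mindex list))"
      "\<And>k. block (A k) k k * block H k k = 1\<^sub>m (length (mlist k :: 'd mindex list))"
    by metis
  define B where "B = (\<lambda>\<alpha> \<beta>. if mdeg \<alpha> = mdeg \<beta> then A (mdeg \<alpha>) \<alpha> \<beta> else 0)"
  have B: "block_diagonal B" by (simp add: block_diagonal_def B_def)
  have block_B: "block B k k = block (A k) k k" for k
    by (auto simp: block_def submat_eq_iff set_mlist mindices_def B_def)
  \<comment> \<open>A row of degree \<open>k\<close> in a block diagonal left factor meets only
    middle labels of degree \<open>k\<close>.\<close>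
  have mult: "block (C \<star> D) k k = block C k k * block D k k" if "block_diagonal C" for C D :: "'d smat" and k
    unfolding block_def using that
    by (intro submat_smult[OF band_block_diagonal[OF that] distinct_mlist])
      (auto simp: set_mlist mindices_def block_diagonal_def)
  have eq: "C = sone" if "block_diagonal C" "\<And>k. block C k k = 1\<^sub>m (length (mlist k :: 'd mindex list))"
    for C :: "'d smat"
  proof (intro ext)
    fix \<alpha> \<beta> :: "'d mindex"
    show "C \<alpha> \<beta> = sone \<alpha> \<beta>"
    proof (cases "mdeg \<alpha> = mdeg \<beta>")
      case True
      let ?xs = "mlist (mdeg \<alpha>) :: 'd mindex list"
      have "submat C ?xs ?xs = submat sone ?xs ?xs"
        using that(2)[of "mdeg \<alpha>"] by (simp add: block_def submat_sone distinct_mlist)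
      with True show ?thesis by (simp add: submat_eq_iff set_mlist mindices_def)
    qed (use that(1) in \<open>auto simp: block_diagonal_def sone_def\<close>)
  qed
  have "H \<star> B = sone"
    by (rule eq[OF block_diagonal_smult[OF H B]]) (simp add: mult[OF H] block_B A(1))
  moreover have "B \<star> H = sone"
    by (rule eq[OF block_diagonal_smult[OF B H]]) (simp add: mult[OF B] block_B A(2))
  ultimately show ?thesis using B by blast
qed

section \<open>Quasi-determinants of the truncated Jacobi matrices\<close>

lemma shifted_jacobi_trunc_eq:
  assumes "block_lower_unitriangular S"
  shows "shifted_jacobi_trunc n c S l =
    submat (S \<star> dir_shift n c \<star> sinv S) (mlist_upto l) (mlist_upto l)"
  unfolding shifted_jacobi_trunc_def dir_jacobi_eq[OF assms] trunc_def
    submat_sone[OF distinct_mlist_upto, symmetric]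
  by (rule eq_matI) (auto simp: submat_def)

text \<open>Rows of degree below \<open>l\<close> meet only labels of degree below \<open>l\<close>,
  so truncation carries \<open>M \<star> sinv M = sone\<close> to finite matrices.\<close>

lemma invertible_submat_unitriangular:
  assumes "block_lower_unitriangular M"
  shows "invertible_mat (submat M (mlist_upto l) (mlist_upto l))"
proof (rule invertible_matI[OF submat_carrier submat_carrier])
  have "submat (M \<star> sinv M) (mlist_upto l) (mlist_upto l)
      = submat M (mlist_upto l) (mlist_upto l) * submat (sinv M) (mlist_upto l) (mlist_upto l)"
    using bandD[OF band_unitriangular[OF assms]]
    by (intro submat_smult[OF band_unitriangular[OF assms] distinct_mlist_upto])
      (auto simp: set_mlist_upto)
  then show "submat M (mlist_upto l) (mlist_upto l) * submat (sinv M) (mlist_upto l) (mlist_upto l)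
      = 1\<^sub>m (length (mlist_upto l :: 'a mindex list))"
    by (simp add: unitriangular_sinv[OF assms] submat_sone distinct_mlist_upto)
qed

lemma invertible_submat_block_diagonal:
  assumes H: "block_diagonal H" and inv: "\<And>k. invertible_mat (block H k k)"
  shows "invertible_mat (submat H (mlist_upto l) (mlist_upto l))"
proof -
  obtain B where B: "H \<star> B = sone"
    using block_diagonal_inverse[OF assms] by blast
  have "submat (H \<star> B) (mlist_upto l) (mlist_upto l)
      = submat H (mlist_upto l) (mlist_upto l) * submat B (mlist_upto l) (mlist_upto l)"
    using bandD[OF band_block_diagonal[OF H]]
    by (intro submat_smult[OF band_block_diagonal[OF H] distinct_mlist_upto])
      (auto simp: set_mlist_upto)
  then show ?thesis
    by (intro invertible_matI[OF submat_carrier submat_carrier[of B]])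
      (simp add: B submat_sone distinct_mlist_upto)
qed

text \<open>The purely algebraic core: the measure enters only through \<open>G\<close>. Since
  \<open>k\<close> indexes the last block, the truncation has \<open>Suc k\<close> block rows, and
  the same quasi-determinant serves block row \<open>Suc k\<close> of the factor
  \<open>S \<star> sinv S'\<close>.\<close>

lemma shifted_jacobi_quasidet:
  fixes S S' H H' :: "'d::{finite,linorder} smat"
  assumes S: "block_lower_unitriangular S" and S': "block_lower_unitriangular S'"
    and H: "block_diagonal H" and H': "block_diagonal H'"
    and H_inv: "\<And>k. invertible_mat (block H k k)" and H'_inv: "\<And>k. invertible_mat (block H' k k)"
    and G: "sinv S' \<star> H' \<star> stransp (sinv S') = dir_shift n c \<star> (sinv S \<star> H \<star> stransp (sinv S))"
  defines "\<theta> k \<equiv> last_quasidet (card (mindices k :: 'd mindex set)) (shifted_jacobi_trunc n c S (Suc k))"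
  shows "last_quasidet_exists (card (mindices k :: 'd mindex set)) (shifted_jacobi_trunc n c S (Suc k))"
    and "invertible_mat (\<theta> k)"
    and "\<theta> k = block H' k k * minv (block H k k)"
    and "block (S \<star> sinv S') (Suc k) k = block (dir_jacobi n S) (Suc k) k * minv (\<theta> k)"
proof -
  let ?L = "dir_shift n c" and ?xs = "mlist_upto k :: 'd mindex list" and ?ys = "mlist k :: 'd mindex list"
  define M where "M = S \<star> sinv S'"
  define U where "U = S' \<star> ?L \<star> sinv S"
  note LU = gauss_borel_shift[OF S S' H H' band_dir_shift G, folded M_def U_def]
  note bM = band_unitriangular[OF LU(4)] and bH' = band_block_diagonal[OF H']
  obtain Hi where Hi: "block_diagonal Hi" "H \<star> Hi = sone"
    using block_diagonal_inverse[OF H H_inv] by blast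
  obtain Hi' where Hi': "block_diagonal Hi'" "Hi' \<star> H' = sone"
    using block_diagonal_inverse[OF H' H'_inv] by blast
  note U0 = upper_factor_zero[OF LU(4,3) H H' Hi LU(2)]
  note M0 = lower_factor_zero[OF LU(4,3) H H' Hi' LU(2)]
  have M1: "M \<alpha> \<beta> = sone \<alpha> \<beta>" if "mdeg \<alpha> = mdeg \<beta>" for \<alpha> \<beta>
    using LU(4) that by (simp add: block_lower_unitriangular_def)
  \<comment> \<open>The condition on \<open>zs\<close> asks for whole degree classes. It covers both
    the truncation \<open>?xs\<close> and the single block \<open>?ys\<close>, and block diagonality
    of \<open>H\<close> and \<open>H'\<close> confines the middle labels to
    \<open>zs\<close>.\<close>
  have UH: "submat U zs zs * submat H zs zs = submat H' zs zs * transpose_mat (submat M zs zs)"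
    if "distinct zs" "\<And>\<alpha> \<beta>. \<alpha> \<in> set zs \<Longrightarrow> mdeg \<alpha> = mdeg \<beta> \<Longrightarrow> \<beta> \<in> set zs" for zs
  proof -
    have "submat (U \<star> H) zs zs = submat U zs zs * submat H zs zs"
      using that(2) H by (intro submat_smult[OF LU(3) that(1)]) (metis block_diagonal_def mult_zero_right)
    moreover have "submat (H' \<star> stransp M) zs zs = submat H' zs zs * submat (stransp M) zs zs"
      using that(2) H' by (intro submat_smult[OF bH' that(1)]) (metis block_diagonal_def mult_zero_left)
    ultimately show ?thesis by (simp add: LU(2) submat_stransp)
  qed
  have inv_M: "invertible_mat (submat M ?xs ?xs)"
    by (rule invertible_submat_unitriangular[OF LU(4)])
  \<comment> \<open>Invertibility of the leading part of \<open>U\<close> comes from the other side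
    of \<open>U \<star> H = H' \<star> stransp M\<close>: there both factors are invertible, and
    \<open>U\<close> is a left factor of an invertible product.\<close>
  have "invertible_mat (submat H' ?xs ?xs * transpose_mat (submat M ?xs ?xs))"
    by (rule invertible_mat_mult[of _ "length ?xs"])
      (simp_all add: invertible_transpose_mat[OF submat_carrier inv_M]
        invertible_submat_block_diagonal[OF H' H'_inv])
  moreover have "submat U ?xs ?xs * submat H ?xs ?xs = submat H' ?xs ?xs * transpose_mat (submat M ?xs ?xs)"
    by (rule UH) (simp_all add: distinct_mlist_upto set_mlist_upto)
  ultimately have inv_U: "invertible_mat (submat U ?xs ?xs)"
    by (metis invertible_mat_left_factor submat_carrier)
  \<comment> \<open>The diagonal blocks of \<open>M\<close> are identities, so \<open>M\<close>
    disappears from the diagonal blocks of the relation.\<close>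
  have "submat M ?ys ?ys = 1\<^sub>m (length ?ys)"
    using M1 by (simp add: submat_eq_iff set_mlist mindices_def distinct_mlist flip: submat_sone)
  then have UH_k: "block U k k * block H k k = block H' k k"
    using UH[of ?ys] by (simp add: block_def distinct_mlist set_mlist mindices_def
        right_mult_one_mat[OF submat_carrier])
  have Hk: "submat H ?ys ?ys \<in> carrier_mat (length ?ys) (length ?ys)" "invertible_mat (submat H ?ys ?ys)"
    using H_inv[of k] by (simp_all add: block_def)
  have U_k: "block H' k k * minv (block H k k) = block U k k"
    using eq_mult_minv[OF Hk submat_carrier[of U ?ys ?ys]] UH_k by (simp add: block_def)
  have inv_U_k: "invertible_mat (block U k k)"
    using invertible_mat_left_factor[OF _ Hk(1), of "submat U ?ys ?ys"] UH_k H'_inv[of k]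
    by (simp add: block_def)
  have dist: "distinct (?xs @ ?ys)"
    using distinct_mlist_upto[of "Suc k"] by (simp only: mlist_upto_Suc)
  have set: "set (?xs @ ?ys) = {\<alpha>. mdeg \<alpha> \<le> k}"
    by (auto simp: set_mlist_upto set_mlist mindices_def)
  \<comment> \<open>Since \<open>M\<close> is block lower triangular, rows of degree at most
    \<open>k\<close> use only middle labels of degree at most \<open>k\<close>, and the truncation
    inherits the factorization.\<close>
  have K: "(S \<star> ?L \<star> sinv S) \<alpha> \<beta> = (\<Sum>\<gamma>\<in>set (?xs @ ?ys). M \<alpha> \<gamma> * U \<gamma> \<beta>)"
    if "\<alpha> \<in> set (?xs @ ?ys)" for \<alpha> \<beta>
    using that unfolding LU(1)[symmetric] set by (intro smult_eq_sum_le[OF bM]) simp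
  have tr: "shifted_jacobi_trunc n c S (Suc k) = submat (S \<star> ?L \<star> sinv S) (?xs @ ?ys) (?xs @ ?ys)"
    by (simp add: shifted_jacobi_trunc_eq[OF S] mlist_upto_Suc)
  note qd = last_quasidet_LU[OF dist K _ _ _ inv_M inv_U, folded tr, unfolded length_mlist]
  show "last_quasidet_exists (card (mindices k :: 'd mindex set)) (shifted_jacobi_trunc n c S (Suc k))"
    by (rule qd) (auto simp: set_mlist_upto set_mlist mindices_def U0 M1 bandD[OF bM])
  have \<theta>: "\<theta> k = block U k k"
    unfolding \<theta>_def block_def
    by (rule qd) (auto simp: set_mlist_upto set_mlist mindices_def U0 M1 bandD[OF bM])
  show "invertible_mat (\<theta> k)" "\<theta> k = block H' k k * minv (block H k k)"
    by (simp_all only: \<theta> U_k inv_U_k)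
  \<comment> \<open>The block is off the diagonal, so subtracting \<open>c\<close> times the
    identity does not change it.\<close>
  have "block (dir_jacobi n S) (Suc k) k = block (S \<star> ?L \<star> sinv S) (Suc k) k"
    by (auto simp: block_def submat_eq_iff dir_jacobi_eq[OF S] sone_def set_mlist mindices_def)
  also have "\<dots> = block M (Suc k) k * block U k k"
    unfolding LU(1)[symmetric] block_def
  proof (rule submat_smult[OF bM distinct_mlist])
    fix \<alpha> \<beta> \<gamma> :: "'d mindex"
    \<comment> \<open>A middle label of degree below \<open>k\<close> is killed by the bidiagonal
      shape of \<open>M\<close>, one of degree above \<open>k\<close> by the upper triangular shape
      of \<open>U\<close>.\<close>
    assume "\<alpha> \<in> set (mlist (Suc k))" "\<beta> \<in> set ?ys" "\<gamma> \<notin> set ?ys"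
    then have "mdeg \<gamma> + 1 < mdeg \<alpha> \<or> mdeg \<beta> < mdeg \<gamma>"
      by (auto simp: set_mlist mindices_def)
    then show "M \<alpha> \<gamma> * U \<gamma> \<beta> = 0" using M0[of \<gamma> \<alpha>] U0[of \<beta> \<gamma>] by auto
  qed
  finally have "block M (Suc k) k * block U k k = block (dir_jacobi n S) (Suc k) k" by simp
  then show "block (S \<star> sinv S') (Suc k) k = block (dir_jacobi n S) (Suc k) k * minv (\<theta> k)"
    unfolding \<theta> M_def[symmetric] using inv_U_k unfolding block_def
    by (intro eq_mult_minv[OF submat_carrier _ submat_carrier, symmetric])
qed

theorem theorem3p1p2:
  fixes N :: "real ^ 'd::{finite,linorder} ^ 'd::{finite,linorder}"
    and q :: "real ^ 'd::{finite,linorder}"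
    and \<mu> :: "(real ^ 'd::{finite,linorder}) measure"
    and S H :: "int ^ 'd::{finite,linorder} \<Rightarrow> 'd smat"
  assumes N_inv: "invertible N"
    and q_nz: "\<And>a. q $ a \<noteq> 0"
    and borel_mu: "sets \<mu> = sets borel"
    and finite_moments: "\<And>\<alpha>. integrable \<mu> (monomial \<alpha>)"
    and supp: "measure_support \<mu> \<subseteq> {x. \<forall>a. \<bar>inner (N $ a) x\<bar> < \<bar>q $ a\<bar>}"
    and S_tri: "\<And>m. block_lower_unitriangular (S m)"
    and H_diag: "\<And>m. block_diagonal (H m)"
    and H_inv: "\<And>m k. invertible_mat (block (H m) k k)"
    and factorization: "\<And>m. moment_matrix \<mu> N q m = sinv (S m) \<star> H m \<star> stransp (sinv (S m))"
  shows "\<forall>m a.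
    (\<forall>k\<ge>1.
       last_quasidet_exists (card (mindices (k - 1) :: 'd mindex set))
         (shifted_jacobi_trunc (N $ a) (q $ a) (S m) k) \<and>
       invertible_mat (last_quasidet (card (mindices (k - 1) :: 'd mindex set))
         (shifted_jacobi_trunc (N $ a) (q $ a) (S m) k)) \<and>
       rho_block S a k m =
         block (dir_jacobi (N $ a) (S m)) k (k - 1) *
         minv (last_quasidet (card (mindices (k - 1) :: 'd mindex set))
           (shifted_jacobi_trunc (N $ a) (q $ a) (S m) k))) \<and>
    (\<forall>k.
       last_quasidet_exists (card (mindices k :: 'd mindex set))
         (shifted_jacobi_trunc (N $ a) (q $ a) (S m) (k + 1)) \<and>
       alpha_block H a k m =
         last_quasidet (card (mindices k :: 'd mindex set))
           (shifted_jacobi_trunc (N $ a) (q $ a) (S m) (k + 1)))"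
proof (intro allI, goal_cases)
  case (1 m a)
  let ?m = "m + axis a 1"
  have "sinv (S ?m) \<star> H ?m \<star> stransp (sinv (S ?m))
      = dir_shift (N $ a) (q $ a) \<star> (sinv (S m) \<star> H m \<star> stransp (sinv (S m)))"
    unfolding factorization[symmetric]
    by (rule moment_matrix_shift[OF N_inv borel_mu finite_moments supp])
  note q = shifted_jacobi_quasidet[OF S_tri S_tri H_diag H_diag H_inv H_inv this]
  \<comment> \<open>For \<open>k \<ge> 1\<close> the formula for \<open>rho_block\<close> is the
    instance at the predecessor of \<open>k\<close>; the formula for \<open>alpha_block\<close> is
    the instance at \<open>k\<close> itself.\<close>
  show ?case
    using q(1,2,4) q(3)[symmetric]
    by (auto dest!: Suc_le_D simp: rho_block_def alpha_block_def latshift_def)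
qed

end
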